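(* Let $n\geq 3$ be an integer and let $q$ be a power of a prime. Then $PG(n,q)$ is pancyclic: for every integer $k$ with $3\leq k\leq q^{n}+q^{n-1}+\cdots+q+1$, a $k$-cycle embeds into $PG(n,q)$.
   Context: $PG(n,q)$ is the projective space whose points are the $1$-dimensional subspaces and whose lines are the $2$-dimensional subspaces of an $(n+1)$-dimensional vector space over the field $GF(q)$, with incidence given by inclusion; it has $q^{n}+q^{n-1}+\cdots+q+1$ points. A $k$-cycle is a graph on $k$ vertices and $k$ edges in which every vertex has degree two. A graph $G$ embeds into $PG(n,q)$ if there is an injective map $\varphi$ from the vertices of $G$ to the points of $PG(n,q)$ such that the induced map sending each edge $vw$ to the line through $\varphi(v)$ and $\varphi(w)$ is injective on edges (distinct edges go to distinct lines). Equivalently, a $k$-cycle embeds if there are $k$ distinct points $P_1,\dots,P_k$ such that the $k$ lines $P_iP_{i+1}$ (indices mod $k$) are pairwise distinct. *)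

theory Defs
  imports Complex_Main "HOL-Number_Theory.Prime_Powers"
begin

definition pg_points :: "('f::field \<Rightarrow> 'v::ab_group_add \<Rightarrow> 'v) \<Rightarrow> 'v set set" where
  "pg_points scale = {P. module.subspace scale P \<and> vector_space.dim scale P = 1}"

definition pg_lines :: "('f::field \<Rightarrow> 'v::ab_group_add \<Rightarrow> 'v) \<Rightarrow> 'v set set" where
  "pg_lines scale = {L. module.subspace scale L \<and> vector_space.dim scale L = 2}"

(* Meant for sets of two distinct points, where the line exists and is unique:
   see line_through_eqI and line_through_eq_span. *)
definition line_through :: "('f::field \<Rightarrow> 'v::ab_group_add \<Rightarrow> 'v) \<Rightarrow> 'v set set \<Rightarrow> 'v set" where
  "line_through scale S = (THE L. L \<in> pg_lines scale \<and> (\<forall>P\<in>S. P \<subseteq> L))"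

(* An edge {v, w} is sent to the line through f v and f w. *)
definition pg_embedding ::
  "('f::field \<Rightarrow> 'v::ab_group_add \<Rightarrow> 'v) \<Rightarrow> 'w set \<Rightarrow> 'w set set \<Rightarrow> ('w \<Rightarrow> 'v set) \<Rightarrow> bool" where
  "pg_embedding scale V E f \<longleftrightarrow>
     f ` V \<subseteq> pg_points scale \<and> inj_on f V \<and> inj_on (\<lambda>e. line_through scale (f ` e)) E"

definition embeds_into_pg ::
  "('f::field \<Rightarrow> 'v::ab_group_add \<Rightarrow> 'v) \<Rightarrow> 'w set \<Rightarrow> 'w set set \<Rightarrow> bool" where
  "embeds_into_pg scale V E \<longleftrightarrow> (\<exists>f. pg_embedding scale V E f)"

context vector_space
begin

lemma point_eq_span:
  assumes "P \<in> pg_points scale"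
  obtains x where "x \<noteq> 0" "P = local.span {x}"
proof -
  have P: "local.subspace P" "local.dim P = 1" using assms by (auto simp: pg_points_def)
  obtain B where B: "B \<subseteq> P" "local.independent B" "P \<subseteq> local.span B" "card B = local.dim P"
    using local.basis_exists .
  then obtain x where x: "B = {x}" using P(2) by (auto simp: card_1_singleton_iff)
  have "local.span B = P"
    using B(3) local.span_minimal[OF B(1) P(1)] by (intro equalityI)
  moreover have "x \<noteq> 0" using B(2) x by (auto simp: local.dependent_zero)
  ultimately show thesis using x by (intro that[of x]) auto
qed

lemma line_unique:
  assumes "P \<in> pg_points scale" "Q \<in> pg_points scale" "P \<noteq> Q"
  shows "L \<in> pg_lines scale \<and> P \<subseteq> L \<and> Q \<subseteq> L \<longleftrightarrow> L = local.span (P \<union> Q)"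
proof -
  obtain x where x: "x \<noteq> 0" "P = local.span {x}" using point_eq_span[OF assms(1)] .
  obtain y where y: "y \<noteq> 0" "Q = local.span {y}" using point_eq_span[OF assms(2)] .
  have nx: "y \<notin> local.span {x}"
  proof
    assume h: "y \<in> local.span {x}"
    then obtain c where c: "y = scale c x" by (auto simp: local.span_singleton)
    then have "c \<noteq> 0" using y(1) by auto
    then have "x = scale (1 / c) y" using c by simp
    then have "x \<in> local.span {y}" by (auto simp: local.span_singleton)
    then have "local.span {x} = local.span {y}" using h by (intro local.span_eq[THEN iffD2]) auto
    then show False using x y assms(3) by simp
  qed
  have ind: "local.independent {y, x}"
    using nx x(1) by (simp add: local.independent_insert)
  have ne: "y \<noteq> x" using nx by (auto intro: local.span_base)
  have PQ: "local.span (P \<union> Q) = local.span {y, x}"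
  proof -
    have "P \<union> Q \<subseteq> local.span {y, x}"
      unfolding x(2) y(2) by (intro Un_least local.span_mono) auto
    moreover have "{y, x} \<subseteq> local.span (P \<union> Q)"
      unfolding x(2) y(2) by (auto intro: local.span_base)
    ultimately show ?thesis by (simp add: local.span_eq)
  qed
  have d: "local.dim {y, x} = 2" using local.dim_eq_card_independent[OF ind] ne by simp
  show ?thesis
  proof
    assume L: "L \<in> pg_lines scale \<and> P \<subseteq> L \<and> Q \<subseteq> L"
    then have sL: "local.subspace L" and dL: "local.dim L = 2" by (auto simp: pg_lines_def)
    have sub: "{y, x} \<subseteq> L" using L x y by (auto intro: local.span_base)
    obtain B where B: "B \<subseteq> L" "local.independent B" "L \<subseteq> local.span B" "card B = local.dim L"
      using local.basis_exists .
    then have fB: "finite B" using dL card.infinite[of B] by (cases "finite B") auto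
    have "L \<subseteq> local.span {y, x}"
    proof (rule ccontr)
      assume "\<not> ?thesis"
      then obtain z where z: "z \<in> L" "z \<notin> local.span {y, x}" by blast
      then have i3: "local.independent {z, y, x}" using nx x(1) by (auto simp: local.independent_insert)
      have "z \<notin> {y, x}" using z(2) by (auto intro: local.span_base)
      then have "card {z, y, x} = 3" using ne by auto
      moreover have "card {z, y, x} \<le> card B"
        using local.independent_span_bound[OF fB i3] sub z(1) B(3) by auto
      ultimately show False using B(4) dL by simp
    qed
    then show "L = local.span (P \<union> Q)"
      using PQ local.span_minimal[OF sub sL] by auto
  next
    assume "L = local.span (P \<union> Q)"
    then show "L \<in> pg_lines scale \<and> P \<subseteq> L \<and> Q \<subseteq> L"
      using PQ d local.span_superset[of "P \<union> Q"] by (auto simp: pg_lines_def)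
  qed
qed

lemma line_through_eqI:
  assumes "P \<in> pg_points scale" "Q \<in> pg_points scale" "P \<noteq> Q"
    and "L \<in> pg_lines scale" "P \<subseteq> L" "Q \<subseteq> L"
  shows "line_through scale {P, Q} = L"
proof -
  have L: "L = local.span (P \<union> Q)"
    using line_unique[OF assms(1-3), of L] assms(4-6) by simp
  have K: "K = L" if "K \<in> pg_lines scale \<and> P \<subseteq> K \<and> Q \<subseteq> K" for K
    using line_unique[OF assms(1-3), of K] that L by simp
  show ?thesis
    unfolding line_through_def
  proof (rule the_equality)
    show "L \<in> pg_lines scale \<and> (\<forall>R\<in>{P, Q}. R \<subseteq> L)" using assms(4-6) by simp
  qed (rule K, simp)
qed

lemma line_through_eq_span:
  assumes "P \<in> pg_points scale" "Q \<in> pg_points scale" "P \<noteq> Q"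
  shows "line_through scale {P, Q} = local.span (P \<union> Q)"
  using line_through_eqI[OF assms] line_unique[OF assms, of "local.span (P \<union> Q)"] by simp

end

definition simple_graph :: "'w set \<Rightarrow> 'w set set \<Rightarrow> bool" where
  "simple_graph V E \<longleftrightarrow> finite V \<and> (\<forall>e\<in>E. e \<subseteq> V \<and> card e = 2)"

definition vertex_degree :: "'w set set \<Rightarrow> 'w \<Rightarrow> nat" where
  "vertex_degree E v = card {e \<in> E. v \<in> e}"

definition connected_graph :: "'w set \<Rightarrow> 'w set set \<Rightarrow> bool" where
  "connected_graph V E \<longleftrightarrow> (\<forall>v\<in>V. \<forall>w\<in>V. (v, w) \<in> {(x, y). {x, y} \<in> E}\<^sup>*)"

(* Without connectedness, disjoint unions of shorter cycles would also qualify. *)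
definition cycle_graph :: "nat \<Rightarrow> 'w set \<Rightarrow> 'w set set \<Rightarrow> bool" where
  "cycle_graph k V E \<longleftrightarrow>
     simple_graph V E \<and> connected_graph V E \<and> card V = k \<and> card E = k \<and>
     (\<forall>v\<in>V. vertex_degree E v = 2)"

end

theory Submission
  imports Defs "HOL-Number_Theory.Residues" "HOL-Algebra.Algebraic_Closure_Type"
begin

text \<open>
  Identify the vector space with the field of order \<open>q ^ (n + 1)\<close>, viewed over its subfield
  \<open>F\<close> of order \<open>q\<close>, and let \<open>g\<close> generate its multiplicative group. The points are the classes of
  \<open>g ^ 0, ..., g ^ (v - 1)\<close>, where \<open>v\<close> is the number of points. Since \<open>n \<ge> 3\<close>, the elements
  \<open>1, g, g\<^sup>2, g\<^sup>3\<close> are independent, so the lines joining \<open>g ^ i\<close> with \<open>g ^ (i + 1)\<close> and those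
  joining \<open>g ^ i\<close> with \<open>g ^ (i + 2)\<close>, for \<open>i < v\<close>, are \<open>2 v\<close> different lines.

  If \<open>v \<le> 2 k\<close>, go once around the exponents modulo \<open>v\<close> with \<open>v - k\<close> steps of length \<open>2\<close> followed by
  steps of length \<open>1\<close>: all lines used are different. If \<open>2 k < v\<close>, take the path
  \<open>g ^ 0, ..., g ^ (k - 2)\<close> and close it through one further point; counting shows that fewer than
  \<open>v\<close> points are on the path or lead to a repeated line.
\<close>

section \<open>Cycles of powers of a Singer generator\<close>

text \<open>\<open>F\<close> is the subfield of scalars and \<open>v\<close> the order of \<open>g\<close> modulo scalars.\<close>

locale singer_cycle =
  fixes F :: "'k::field set" and g :: 'k and q v :: nat
  assumes zero_F [simp]: "0 \<in> F" and one_F [simp]: "1 \<in> F"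
    and add_F: "a \<in> F \<Longrightarrow> b \<in> F \<Longrightarrow> a + b \<in> F"
    and mult_F: "a \<in> F \<Longrightarrow> b \<in> F \<Longrightarrow> a * b \<in> F"
    and minus_F: "a \<in> F \<Longrightarrow> - a \<in> F"
    and inverse_F: "a \<in> F \<Longrightarrow> inverse a \<in> F"
    and card_F: "card F = q" and q_ge_2: "q \<ge> 2"
    and g_nz [simp]: "g \<noteq> 0"
    and power_in_F_iff: "g ^ i \<in> F \<longleftrightarrow> v dvd i"
    and powers_independent:
      "\<lbrakk>a \<in> F; b \<in> F; c \<in> F; d \<in> F; a + b * g + c * g ^ 2 + d * g ^ 3 = 0\<rbrakk>
        \<Longrightarrow> a = 0 \<and> b = 0 \<and> c = 0 \<and> d = 0"
    and power4: "a \<in> F \<Longrightarrow> b \<in> F \<Longrightarrow> g ^ 4 \<noteq> a + b * g ^ 2"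
    and v_ge: "v \<ge> q ^ 3 + q ^ 2 + q + 1"
begin

lemma finite_F [simp]: "finite F"
  using card_F q_ge_2 card.infinite by fastforce

lemma diff_F: "a \<in> F \<Longrightarrow> b \<in> F \<Longrightarrow> a - b \<in> F"
  using add_F minus_F by (metis diff_conv_add_uminus)

lemma divide_F: "a \<in> F \<Longrightarrow> b \<in> F \<Longrightarrow> a / b \<in> F"
  using mult_F inverse_F by (simp add: divide_inverse)

lemmas F_closed = add_F mult_F minus_F inverse_F diff_F divide_F

section \<open>Lines through powers of the generator\<close>

definition line :: "'k \<Rightarrow> 'k \<Rightarrow> 'k set" where
  "line u w = {a * u + b * w | a b. a \<in> F \<and> b \<in> F}"

lemma line_left [simp]: "u \<in> line u w" and line_right [simp]: "w \<in> line u w"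
proof -
  have "u = 1 * u + 0 * w" "w = 0 * u + 1 * w" by auto
  then show "u \<in> line u w" "w \<in> line u w" unfolding line_def using zero_F one_F by blast+
qed

lemma line_scale_right:
  assumes "c \<in> F" "c \<noteq> 0"
  shows "line u (c * w) = line u w"
proof -
  have "a * u + b * (c * w) = a * u + (b * c) * w" "a * u + b * w = a * u + (b / c) * (c * w)" for a b
    using assms by auto
  then show ?thesis unfolding line_def
    using assms(1) mult_F divide_F by blast
qed

text \<open>The quotient of two proportional powers is a power of \<open>g\<close> lying in
  \<open>F\<close>, so \<open>v\<close> divides the difference of the exponents, which is smaller
  than \<open>v\<close>. Hence distinct exponents below \<open>v\<close> name distinct
  points.\<close>

lemma power_eq_scale:
  assumes "i < v" "j < v" "c \<in> F" "g ^ i = c * g ^ j"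
  shows "i = j"
proof -
  have aux: "i = j" if "j \<le> i" "i < v" "c \<in> F" "g ^ i = c * g ^ j" for i j c
  proof -
    have "g ^ i = g ^ (i - j) * g ^ j" using that by (simp flip: power_add)
    then have "g ^ (i - j) \<in> F" using that by simp
    then have "v dvd i - j" by (simp add: power_in_F_iff)
    then show ?thesis using that nat_dvd_not_less[of "i - j" v] by (cases "i = j") auto
  qed
  show ?thesis
  proof (cases "j \<le> i")
    case True
    then show ?thesis using aux assms by blast
  next
    case False
    have "c \<noteq> 0" using assms(4) by auto
    then have "g ^ j = inverse c * g ^ i" using assms(4) by (simp add: field_simps)
    then show ?thesis using aux[of i j "inverse c"] False assms inverse_F by auto
  qed
qed

lemma power_in_lineE:
  assumes "g ^ e \<in> line (g ^ i) (g ^ (i + d))"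
  obtains a b where "a \<in> F" "b \<in> F" "g ^ e = g ^ i * (a + b * g ^ d)"
proof -
  obtain a b where "a \<in> F" "b \<in> F" "g ^ e = a * g ^ i + b * g ^ (i + d)"
    using assms unfolding line_def by blast
  then show thesis by (intro that[of a b]) (auto simp: power_add algebra_simps)
qed

abbreviation "step1 i \<equiv> line (g ^ i) (g ^ (i + 1))"
abbreviation "step2 i \<equiv> line (g ^ i) (g ^ (i + 2))"

text \<open>Write \<open>g ^ j\<close> as \<open>g ^ i * (a + b * g)\<close>. Since
  \<open>g ^ (j + 1)\<close> lies on the same line, comparing coefficients of \<open>g ^ 2\<close>
  forces \<open>b = 0\<close>, so \<open>g ^ j\<close> is a multiple of
  \<open>g ^ i\<close>.\<close>

lemma step1_inj:
  assumes "step1 i = step1 j" "i < v" "j < v"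
  shows "i = j"
proof -
  have "g ^ j \<in> step1 i" "g ^ (j + 1) \<in> step1 i" using assms(1) by auto
  then obtain a b c d where F: "a \<in> F" "b \<in> F" "c \<in> F" "d \<in> F"
    and 1: "g ^ j = g ^ i * (a + b * g ^ 1)" and 2: "g ^ (j + 1) = g ^ i * (c + d * g ^ 1)"
    by (elim power_in_lineE) blast
  have "g ^ i * (g * (a + b * g)) = g ^ i * (c + d * g)" using 1 2 by (simp add: mult.left_commute)
  then have "g * (a + b * g) = c + d * g" by simp
  then have "- c + (a - d) * g + b * g ^ 2 + 0 * g ^ 3 = 0"
    by (simp add: algebra_simps power2_eq_square)
  then have "b = 0"
    using powers_independent[of "- c" "a - d" b 0] F F_closed by simp
  then show ?thesis using power_eq_scale[of j i a] 1 F assms by (simp add: mult.commute)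
qed

text \<open>The argument of \<open>step1_inj\<close> with \<open>g ^ 2\<close> in place of
  \<open>g\<close>. Independence of the powers up to \<open>g ^ 3\<close> does not reach the term
  \<open>g ^ 4\<close> that arises here, which is why \<open>power4\<close> is a separate
  assumption.\<close>

lemma step2_inj:
  assumes "step2 i = step2 j" "i < v" "j < v"
  shows "i = j"
proof -
  have "g ^ j \<in> step2 i" "g ^ (j + 2) \<in> step2 i" using assms(1) by auto
  then obtain a b c d where F: "a \<in> F" "b \<in> F" "c \<in> F" "d \<in> F"
    and 1: "g ^ j = g ^ i * (a + b * g ^ 2)" and 2: "g ^ (j + 2) = g ^ i * (c + d * g ^ 2)"
    by (elim power_in_lineE) blast
  have "g ^ i * (g ^ 2 * (a + b * g ^ 2)) = g ^ i * (c + d * g ^ 2)"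
    using 1 2 by (simp add: mult.left_commute power2_eq_square)
  then have eq: "g ^ 2 * (a + b * g ^ 2) = c + d * g ^ 2" by simp
  have "b = 0"
  proof (rule ccontr)
    assume "b \<noteq> 0"
    have "b * g ^ 4 = c + (d - a) * g ^ 2"
      using eq by (simp add: algebra_simps flip: power_add)
    then have "g ^ 4 = c / b + ((d - a) / b) * g ^ 2"
      using \<open>b \<noteq> 0\<close> by (simp add: field_simps)
    then show False using power4 F F_closed by metis
  qed
  then show ?thesis using power_eq_scale[of j i a] 1 F assms by (simp add: mult.commute)
qed

text \<open>Shifting \<open>a + b * g\<close> by \<open>g ^ 2\<close> moves it to degrees two and
  three, while the line only offers degrees zero and one. Independence of all four powers makes both
  coefficients vanish.\<close>

lemma step1_neq_step2: "step1 i \<noteq> step2 j"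
proof
  assume "step1 i = step2 j"
  then have "g ^ j \<in> step1 i" "g ^ (j + 2) \<in> step1 i" by auto
  then obtain a b c d where F: "a \<in> F" "b \<in> F" "c \<in> F" "d \<in> F"
    and 1: "g ^ j = g ^ i * (a + b * g ^ 1)" and 2: "g ^ (j + 2) = g ^ i * (c + d * g ^ 1)"
    by (elim power_in_lineE) blast
  have "g ^ i * (g ^ 2 * (a + b * g)) = g ^ i * (c + d * g)"
    using 1 2 by (simp add: mult.left_commute power2_eq_square)
  then have "g ^ 2 * (a + b * g) = c + d * g" by simp
  then have "- c + (- d) * g + a * g ^ 2 + b * g ^ 3 = 0"
    by (simp add: algebra_simps power2_eq_square power3_eq_cube)
  then have "a = 0" "b = 0"
    using powers_independent[of "- c" "- d" a b] F F_closed by simp_all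
  then show False using 1 by simp
qed

section \<open>Counting points on secants\<close>

definition secant :: "nat \<Rightarrow> nat \<Rightarrow> nat set" where
  "secant i j = {e. e < v \<and> g ^ e \<in> line (g ^ i) (g ^ j)}"

lemma finite_secant [simp]: "finite (secant i j)"
  unfolding secant_def by simp

text \<open>A point of a line other than two given ones is determined by the ratio of its coordinates.\<close>

lemma card_secant_minus2:
  assumes "i < v" "j < v"
  shows "card (secant i j - {i, j}) \<le> q - 1"
proof -
  define R where "R r e \<longleftrightarrow> e < v \<and> (\<exists>b\<in>F - {0}. g ^ e = b * (r * g ^ i + g ^ j))" for r e
  have R_unique: "e = e'" if "R r e" "R r e'" for r e e'
  proof -
    obtain b b' where b: "b \<in> F" "b \<noteq> 0" "g ^ e = b * (r * g ^ i + g ^ j)"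
        "b' \<in> F" "b' \<noteq> 0" "g ^ e' = b' * (r * g ^ i + g ^ j)"
      using \<open>R r e\<close> \<open>R r e'\<close> unfolding R_def by auto
    then have "g ^ e = (b / b') * g ^ e'" by simp
    then show ?thesis using that b power_eq_scale divide_F unfolding R_def by blast
  qed
  have "secant i j - {i, j} \<subseteq> (\<lambda>r. SOME e. R r e) ` (F - {0})"
  proof
    fix e assume e: "e \<in> secant i j - {i, j}"
    then obtain a b where ab: "a \<in> F" "b \<in> F" "g ^ e = a * g ^ i + b * g ^ j"
      unfolding secant_def line_def by auto
    have "e < v" using e by (simp add: secant_def)
    have "b \<noteq> 0" using power_eq_scale[of e i a] ab e assms \<open>e < v\<close> by auto
    have "a \<noteq> 0" using power_eq_scale[of e j b] ab e assms \<open>e < v\<close> by auto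
    have "R (a / b) e"
      unfolding R_def using \<open>e < v\<close> \<open>b \<noteq> 0\<close> ab
      by (intro conjI bexI[of _ b]) (auto simp: field_simps)
    then have "e = (SOME e. R (a / b) e)" by (metis R_unique someI)
    then show "e \<in> (\<lambda>r. SOME e. R r e) ` (F - {0})"
      using \<open>a \<noteq> 0\<close> \<open>b \<noteq> 0\<close> ab divide_F by auto
  qed
  then have "card (secant i j - {i, j}) \<le> card (F - {0})"
    by (meson card_image_le card_mono finite_F finite_Diff finite_imageI le_trans)
  then show ?thesis using card_F by simp
qed

lemma card_secant_minus1:
  assumes "i < v" "j < v"
  shows "card (secant i j - {i}) \<le> q"
proof -
  have "card (insert j (secant i j - {i, j})) \<le> q"
    using card_insert_le_m1[of q "secant i j - {i, j}" j] card_secant_minus2[OF assms] q_ge_2 by simp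
  moreover have "secant i j - {i} \<subseteq> insert j (secant i j - {i, j})" by auto
  ultimately show ?thesis
    by (meson card_mono finite_Diff finite_insert finite_secant le_trans)
qed

text \<open>As \<open>g ^ v\<close> is a scalar, multiplication by \<open>g ^ (v - i)\<close>
  rotates \<open>step1 i\<close> onto \<open>step1 0\<close> and takes the point of \<open>1\<close>
  to that of \<open>g ^ (v - i)\<close>.\<close>

lemma step1_contains_0:
  assumes "0 < i" "i < v" "1 \<in> step1 i"
  shows "v - i \<in> secant 0 1"
proof -
  obtain a b where F: "a \<in> F" "b \<in> F" and e: "g ^ 0 = g ^ i * (a + b * g ^ 1)"
    using power_in_lineE[of 0 i 1] assms by auto
  have "g ^ v \<in> F" by (simp add: power_in_F_iff)
  have "g ^ i * g ^ (v - i) = g ^ v" using assms by (simp flip: power_add)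
  also have "\<dots> = g ^ 0 * g ^ v" by simp
  also have "\<dots> = g ^ i * ((a * g ^ v) + (b * g ^ v) * g)" unfolding e by (simp add: algebra_simps)
  finally have "g ^ (v - i) = (a * g ^ v) * g ^ 0 + (b * g ^ v) * g ^ 1" by simp
  then show ?thesis unfolding secant_def line_def
    using assms F \<open>g ^ v \<in> F\<close> mult_F by fastforce
qed

lemma step1_contains_later:
  assumes "i \<le> m" "m < v" "g ^ m \<in> step1 i"
  shows "m - i \<in> secant 0 1"
proof -
  obtain a b where F: "a \<in> F" "b \<in> F" and e: "g ^ m = g ^ i * (a + b * g ^ 1)"
    using power_in_lineE[of m i 1] assms by auto
  have "g ^ i * g ^ (m - i) = g ^ m" using assms by (simp flip: power_add)
  then have "g ^ (m - i) = a * g ^ 0 + b * g ^ 1" using e by simp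
  then show ?thesis unfolding secant_def line_def using assms F by fastforce
qed

text \<open>
  The points that cannot close the path \<open>g ^ 0, ..., g ^ m\<close>. A line of the path through \<open>g ^ 0\<close> or
  \<open>g ^ m\<close>, other than its first and last one, is \<open>step1 (v - d)\<close> or \<open>step1 (m - d)\<close> with \<open>g ^ d\<close> on
  \<open>step1 0\<close> and \<open>2 \<le> d\<close>, which leaves at most \<open>q - 1\<close> values of \<open>d\<close>.
\<close>

definition detours :: "nat \<Rightarrow> nat set" where
  "detours m = {0..m} \<union> (secant 0 1 - {0, 1}) \<union> (secant (m - 1) m - {m - 1, m})
     \<union> (secant 0 m - {0, m})
     \<union> (\<Union>d\<in>secant 0 1 - {0, 1}. secant (v - d) (v - d + 1) - {v - d})
     \<union> (\<Union>d\<in>secant 0 1 - {0, 1}. if d \<le> m then secant (m - d) (m - d + 1) - {m - d} else {})"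


text \<open>The path has \<open>m + 1\<close> points, three lines without two of their points
  contribute at most \<open>q - 1\<close> each, and each of the two unions ranges over at most
  \<open>q - 1\<close> lines with at most \<open>q\<close> remaining points.\<close>

lemma card_detours:
  assumes "0 < m" "m < v"
  shows "card (detours m) \<le> (m + 1) + 3 * (q - 1) + 2 * ((q - 1) * q)"
proof -
  let ?D = "secant 0 1 - {0, 1}"
  have v: "1 < v" using assms by simp
  have D: "card ?D \<le> q - 1" using card_secant_minus2[of 0 1] v by simp
  \<comment> \<open>The lower bound keeps the exponent \<open>v - d + 1\<close> below
    \<open>v\<close>, as \<open>card_secant_minus1\<close> requires.\<close>
  have d: "2 \<le> d" "d < v" if "d \<in> ?D" for d using that by (auto simp: secant_def)
  have UN: "card (\<Union>d\<in>?D. A d) \<le> (q - 1) * q" if "\<And>d. d \<in> ?D \<Longrightarrow> card (A d) \<le> q" for A :: "nat \<Rightarrow> nat set"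
  proof -
    have "card (\<Union>d\<in>?D. A d) \<le> (\<Sum>d\<in>?D. card (A d))" by (rule card_UN_le) simp
    also have "\<dots> \<le> of_nat (card ?D) * q" using that by (rule sum_bounded_above)
    also have "\<dots> \<le> (q - 1) * q" using D by simp
    finally show ?thesis .
  qed
  have "card (\<Union>d\<in>?D. secant (v - d) (v - d + 1) - {v - d}) \<le> (q - 1) * q"
  proof (rule UN)
    fix e assume e: "e \<in> ?D"
    show "card (secant (v - e) (v - e + 1) - {v - e}) \<le> q"
      using card_secant_minus1[of "v - e" "v - e + 1"] d[OF e] by linarith
  qed
  moreover have "card (\<Union>d\<in>?D. if d \<le> m then secant (m - d) (m - d + 1) - {m - d} else {}) \<le> (q - 1) * q"
  proof (rule UN)
    fix e assume e: "e \<in> ?D"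
    show "card (if e \<le> m then secant (m - e) (m - e + 1) - {m - e} else {}) \<le> q"
      using card_secant_minus1[of "m - e" "m - e + 1"] d[OF e] assms by auto
  qed
  moreover have "card (secant (m - 1) m - {m - 1, m}) \<le> q - 1" "card (secant 0 m - {0, m}) \<le> q - 1"
    using card_secant_minus2 assms by simp_all
  moreover have "card {0..m} \<le> m + 1" by simp
  moreover have Un: "card (A \<union> B) \<le> a + b" if "card A \<le> a" "card B \<le> b" for A B :: "nat set" and a b
    using card_Un_le[of A B] that by linarith
  ultimately have "card (detours m) \<le> m + 1 + (q - 1) + (q - 1) + (q - 1) + (q - 1) * q + (q - 1) * q"
    unfolding detours_def using D by (intro Un)
  then show ?thesis by simp
qed

section \<open>Cycles of every length\<close>

lemma cycle_short:
  assumes "3 \<le> k" "k + 2 * q ^ 2 + q < v + 4"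
  shows "\<exists>s. (\<forall>i<k. s i < v) \<and> inj_on s {..<k} \<and>
     inj_on (\<lambda>i. line (g ^ s i) (g ^ s (Suc i mod k))) {..<k}"
proof -
  define m where "m = k - 2"
  have k: "k = m + 2" and m: "0 < m" using assms(1) by (auto simp: m_def)
  have "4 \<le> 2 * q" "2 * q \<le> q ^ 2" using q_ge_2 by (auto simp: power2_eq_square)
  then have mv: "m + 2 \<le> v" using assms(2) k by linarith
  obtain p where p: "q = Suc p" using q_ge_2 by (cases q) auto
  \<comment> \<open>With \<open>k = m + 2\<close>, the bound of \<open>card_detours\<close> is
    \<open>k + 2 * q ^ 2 + q - 4\<close>.\<close>
  have "(m + 1) + 3 * (q - 1) + 2 * ((q - 1) * q) < v"
    using assms(2) unfolding k p by (simp add: power2_eq_square algebra_simps)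
  then have "card (detours m) < card {..<v}" using card_detours[of m] m mv by simp
  moreover have "finite (detours m)" by (simp add: detours_def)
  ultimately have "\<not> {..<v} \<subseteq> detours m" using card_mono not_le by blast
  then obtain e where e: "e < v" "e \<notin> detours m" by auto
  have em: "m < e" using e by (auto simp: detours_def)
  define s where "s i = (if i \<le> m then i else e)" for i
  define l where "l i = line (g ^ s i) (g ^ s (Suc i mod k))" for i
  have l1: "l i = step1 i" if "i < m" for i using that k by (simp add: l_def s_def)
  have l2: "l m = line (g ^ m) (g ^ e)" using k by (simp add: l_def s_def)
  have l3: "l (Suc m) = line (g ^ e) 1" using k by (simp add: l_def s_def)
  \<comment> \<open>Such a line would meet the path again in \<open>g ^ m\<close>. Then
    \<open>e\<close> lies on the last step of the path if \<open>i = m - 1\<close>, and otherwise in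
    the union of \<open>detours\<close> indexed by \<open>d = m - i\<close>.\<close>
  have l_m: "l m \<noteq> step1 i" if "i < m" for i
  proof
    assume "l m = step1 i"
    then have mem: "g ^ m \<in> step1 i" "g ^ e \<in> step1 i" unfolding l2 by (metis line_left line_right)+
    have mi: "m - i \<in> secant 0 1" using step1_contains_later mem that mv by simp
    have "e \<in> secant i (i + 1)" using mem e by (simp add: secant_def)
    show False
    proof (cases "i = m - 1")
      case True
      then have "e \<in> secant (m - 1) m - {m - 1, m}" using \<open>e \<in> secant i (i + 1)\<close> m em by simp
      then show False using e by (simp add: detours_def)
    next
      case False
      then have "m - i \<in> secant 0 1 - {0, 1}" using mi that by auto
      moreover have "e \<in> secant (m - (m - i)) (m - (m - i) + 1) - {m - (m - i)}"
        using \<open>e \<in> secant i (i + 1)\<close> that em by simp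
      ultimately have "e \<in> (\<Union>d\<in>secant 0 1 - {0, 1}. if d \<le> m then secant (m - d) (m - d + 1) - {m - d} else {})"
        by (intro UN_I[of "m - i"]) simp_all
      then show False using e unfolding detours_def by blast
    qed
  qed
  \<comment> \<open>The same at the other end: \<open>e\<close> lies on the first step if
    \<open>i = 0\<close>, and otherwise in the union indexed by \<open>d = v - i\<close>.\<close>
  have l_Suc_m: "l (Suc m) \<noteq> step1 i" if "i < m" for i
  proof
    assume "l (Suc m) = step1 i"
    then have mem: "1 \<in> step1 i" "g ^ e \<in> step1 i" unfolding l3 by (metis line_left line_right)+
    have "e \<in> secant i (i + 1)" using mem e by (simp add: secant_def)
    show False
    proof (cases "i = 0")
      case True
      then have "e \<in> secant 0 1 - {0, 1}" using \<open>e \<in> secant i (i + 1)\<close> m em by simp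
      then show False using e by (simp add: detours_def)
    next
      case False
      have "v - i \<in> secant 0 1" using step1_contains_0[of i] mem False that mv by simp
      then have "v - i \<in> secant 0 1 - {0, 1}" using that mv by auto
      moreover have "e \<in> secant (v - (v - i)) (v - (v - i) + 1) - {v - (v - i)}"
        using \<open>e \<in> secant i (i + 1)\<close> that em mv by simp
      ultimately have "e \<in> (\<Union>d\<in>secant 0 1 - {0, 1}. secant (v - d) (v - d + 1) - {v - d})"
        by (rule UN_I)
      then show False using e unfolding detours_def by blast
    qed
  qed
  \<comment> \<open>If the two closing lines coincide, then \<open>1\<close>, \<open>g ^ m\<close>
    and \<open>g ^ e\<close> are collinear, which the part \<open>secant 0 m\<close> of
    \<open>detours\<close> excludes.\<close>
  have l_m_Suc_m: "l m \<noteq> l (Suc m)"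
  proof
    assume "l m = l (Suc m)"
    then have "1 \<in> line (g ^ m) (g ^ e)" unfolding l2 l3 by simp
    then obtain a b where ab: "a \<in> F" "b \<in> F" "1 = a * g ^ m + b * g ^ e" unfolding line_def by blast
    have "b \<noteq> 0"
      using power_eq_scale[of 0 m a] ab m mv by auto
    then have "g ^ e = inverse b * g ^ 0 + (- a / b) * g ^ m" using ab by (simp add: field_simps)
    moreover have "inverse b \<in> F" "- a / b \<in> F" using ab F_closed by simp_all
    ultimately have "g ^ e \<in> line (g ^ 0) (g ^ m)" unfolding line_def by blast
    then have "e \<in> secant 0 m - {0, m}" using e em by (simp add: secant_def)
    then show False using e by (simp add: detours_def)
  qed
  have l_neq: "l i \<noteq> l j" if "i < j" "j < k" for i j
  proof -
    consider "j < m" | "j = m" | "j = Suc m" "i < m \<or> i = m" using \<open>i < j\<close> \<open>j < k\<close> k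
      by (metis add_2_eq_Suc' less_Suc_eq)
    then show ?thesis
    proof cases
      case 1
      then show ?thesis using l1[of i] l1[of j] step1_inj[of i j] that mv by auto
    next
      case 2
      then show ?thesis using l_m[of i] l1[of i] that by auto
    next
      case 3
      then show ?thesis using l_Suc_m[of i] l_m_Suc_m l1[of i] by auto
    qed
  qed
  have "inj_on l {..<k}"
    by (rule linorder_inj_onI) (use l_neq in auto)
  moreover have "inj_on s {..<k}" using k em by (auto simp: s_def inj_on_def)
  moreover have "\<forall>i<k. s i < v" using e mv by (simp add: s_def)
  ultimately show ?thesis unfolding l_def by blast
qed

lemma cycle_long:
  assumes "k \<le> v" "v \<le> 2 * k" "0 < k"
  shows "\<exists>s. (\<forall>i<k. s i < v) \<and> inj_on s {..<k} \<and>
     inj_on (\<lambda>i. line (g ^ s i) (g ^ s (Suc i mod k))) {..<k}"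
proof -
  define d where "d = v - k"
  \<comment> \<open>The \<open>d\<close> double steps and \<open>k - d\<close> single steps advance
    the exponent by \<open>2 * d + (k - d) = v\<close>, once around. The bound
    \<open>v \<le> 2 * k\<close> ensures \<open>d \<le> k\<close>.\<close>
  define s where "s i = (if i < d then 2 * i else d + i)" for i
  define l where "l i = line (g ^ s i) (g ^ s (Suc i mod k))" for i
  have d: "d \<le> k" "d + k = v" using assms by (auto simp: d_def)
  have smono: "s i < s j" if "i < j" for i j using that by (simp add: s_def)
  have sv: "s i < v" if "i < k" for i using that d by (simp add: s_def)
  have s_eq: "i = j" if "s i = s j" for i j using that smono by (metis less_irrefl linorder_neqE_nat)
  \<comment> \<open>As \<open>g ^ v\<close> is a scalar, the closing edge back to
    \<open>g ^ 0\<close> is an ordinary step from the last exponent to \<open>v\<close>.\<close>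
  have wrap: "line u (g ^ v) = line u (g ^ 0)" for u
    using line_scale_right[of "g ^ v" u 1] by (simp add: power_in_F_iff)
  have l: "l i = (if i < d then step2 (s i) else step1 (s i))" if "i < k" for i
  proof -
    have "l i = line (g ^ s i) (g ^ s (Suc i))"
    proof (cases "Suc i = k")
      case True
      have "s k = v" "s 0 = 0" using d by (auto simp: s_def)
      then show ?thesis unfolding l_def using True wrap by simp
    qed (use that in \<open>simp add: l_def\<close>)
    moreover have "s (Suc i) = (if i < d then s i + 2 else s i + 1)" by (auto simp: s_def)
    ultimately show ?thesis by simp
  qed
  have "inj_on l {..<k}"
  proof (rule inj_onI)
    fix i j assume "i \<in> {..<k}" "j \<in> {..<k}" and eq: "l i = l j"
    then have ij: "i < k" "j < k" by auto
    have "s i = s j"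
      using eq ij step1_inj[of "s i" "s j"] step2_inj[of "s i" "s j"] sv[of i] sv[of j]
        step1_neq_step2[of "s i" "s j"] step1_neq_step2[of "s j" "s i"]
      unfolding l[OF ij(1)] l[OF ij(2)] by (metis (full_types))
    then show "i = j" by (rule s_eq)
  qed
  moreover have "inj_on s {..<k}" using s_eq by (auto simp: inj_on_def)
  ultimately show ?thesis using sv unfolding l_def by blast
qed

lemma cycle_exists:
  assumes "3 \<le> k" "k \<le> v"
  shows "\<exists>s. (\<forall>i<k. s i < v) \<and> inj_on s {..<k} \<and>
     inj_on (\<lambda>i. line (g ^ s i) (g ^ s (Suc i mod k))) {..<k}"
proof (cases "v \<le> 2 * k")
  case True
  then show ?thesis using cycle_long assms by simp
next
  case False
  \<comment> \<open>This is twice the inequality needed for \<open>cycle_short\<close>, after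
    inserting \<open>2 * k + 1 \<le> v\<close> and \<open>v_ge\<close>; the constants add up to
    \<open>10\<close>.\<close>
  have "4 * q ^ 2 + 2 * q < q ^ 3 + q ^ 2 + q + 10"
  proof (cases "q \<ge> 4")
    case True
    then have "4 * (q * q) \<le> q * (q * q)" "q \<le> q * q" by simp_all
    then show ?thesis unfolding power2_eq_square power3_eq_cube mult.assoc by linarith
  next
    case False
    then have "q = 2 \<or> q = 3" using q_ge_2 by auto
    then show ?thesis by auto
  qed
  then have "k + 2 * q ^ 2 + q < v + 4" using False v_ge by linarith
  then show ?thesis using cycle_short assms by simp
qed

end

section \<open>Existence of a Singer generator\<close>

text \<open>Multiplication by \<open>x\<close> permutes \<open>H\<close>, so it preserves the
  product of all elements, yet multiplies it by \<open>x ^ card H\<close>.\<close>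

lemma power_card_eq_1:
  fixes H :: "'a::field set"
  assumes "finite H" "0 \<notin> H" "\<And>x y. x \<in> H \<Longrightarrow> y \<in> H \<Longrightarrow> x * y \<in> H" "x \<in> H"
  shows "x ^ card H = 1"
proof -
  have "inj_on ((*) x) H" using assms by (auto simp: inj_on_def)
  moreover have "(*) x ` H \<subseteq> H" using assms by auto
  ultimately have bij: "(*) x ` H = H" using assms(1) by (simp add: card_image card_subset_eq)
  have "\<Prod>H = (\<Prod>y\<in>H. x * y)"
    using prod.reindex[OF \<open>inj_on ((*) x) H\<close>, of id] bij by simp
  then have "\<Prod>H = x ^ card H * \<Prod>H" by (simp add: prod.distrib)
  moreover have "\<Prod>H \<noteq> 0" using assms by (simp add: prod_zero_iff)
  ultimately show ?thesis by simp
qed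

text \<open>The polynomial X^Q - X has derivative -1 because \<open>Q\<close> vanishes in the field.
  Its roots are therefore simple, and it splits over an algebraically closed field.\<close>

lemma card_fixed_points_power:
  assumes "of_nat Q = (0 :: 'k::alg_closed_field)" "2 \<le> Q"
  shows "finite {x :: 'k. x ^ Q = x}" "card {x :: 'k. x ^ Q = x} = Q"
proof -
  define p :: "'k poly" where "p = monom 1 Q - monom 1 1"
  have "degree (monom 1 1 :: 'k poly) < degree (monom 1 Q :: 'k poly)"
    using assms(2) by (simp add: degree_monom_eq)
  then have deg: "degree p = Q"
    unfolding p_def diff_conv_add_uminus
    by (subst degree_add_eq_left) (use assms(2) in \<open>simp_all add: degree_monom_eq\<close>)
  have roots: "poly p x = 0 \<longleftrightarrow> x ^ Q = x" for x by (simp add: p_def poly_monom)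
  have pderiv: "pderiv p = - 1"
    using assms(1) by (simp add: p_def pderiv_diff pderiv_monom one_pCons monom_0)
  have p0: "p \<noteq> 0" using deg assms(2) by auto
  then obtain A where A: "size A = degree p" "p = smult (lead_coeff p) (\<Prod>x\<in>#A. [:-x, 1:])"
    using alg_closed_imp_factorization by blast
  have lead: "lead_coeff p \<noteq> 0" using p0 by simp
  have simple: "count A x \<le> 1" for x
  proof (rule ccontr)
    assume "\<not> ?thesis"
    then have "{#x, x#} \<subseteq># A" by (auto simp: subseteq_mset_def)
    then obtain B where "A = {#x, x#} + B" by (auto simp: subset_mset.le_iff_add)
    define f where "f = [:-x, 1:]"
    have "p = smult (lead_coeff p) (f * (f * (\<Prod>x\<in>#B. [:-x, 1:])))"
      using A(2) \<open>A = _\<close> by (simp add: f_def)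
    then obtain r where "p = f * (f * r)" by (metis mult_smult_right)
    moreover have "poly f x = 0" by (simp add: f_def)
    ultimately have "poly (pderiv p) x = 0" by (simp add: pderiv_mult)
    then show False using pderiv by simp
  qed
  have set: "set_mset A = {x. x ^ Q = x}"
  proof -
    have "poly p x = 0 \<longleftrightarrow> x \<in># A" for x
      by (subst A(2)) (use lead in \<open>auto simp: poly_prod_mset prod_mset_zero_iff\<close>)
    then show ?thesis using roots by auto
  qed
  have "size A = (\<Sum>x\<in>set_mset A. count A x)" by (rule size_multiset_overloaded_eq)
  also have "\<dots> = (\<Sum>x\<in>set_mset A. 1)"
    by (rule sum.cong) (use simple in \<open>auto simp: le_antisym\<close>)
  finally have "card (set_mset A) = Q" using A(1) deg by simp
  then show "finite {x :: 'k. x ^ Q = x}" "card {x :: 'k. x ^ Q = x} = Q"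
    unfolding set[symmetric] by simp_all
qed

text \<open>The subset is packed into a ring record so that the cyclicity of the multiplicative
  group of a finite field applies.\<close>

lemma finite_subfield_generator:
  fixes S :: "'k::field set"
  assumes "finite S" "0 \<in> S" "1 \<in> S"
    and "\<And>x y. x \<in> S \<Longrightarrow> y \<in> S \<Longrightarrow> x + y \<in> S" "\<And>x y. x \<in> S \<Longrightarrow> y \<in> S \<Longrightarrow> x * y \<in> S"
    and "\<And>x. x \<in> S \<Longrightarrow> - x \<in> S" "\<And>x. x \<in> S \<Longrightarrow> inverse x \<in> S"
  obtains g where "g \<in> S" "g \<noteq> 0" "S - {0} = range (\<lambda>i::nat. g ^ i)"
proof -
  define R :: "'k ring" where
    "R = \<lparr>carrier = S, monoid.mult = (\<lambda>x y. x * y), one = 1, ring.zero = 0, add = (\<lambda>x y. x + y)\<rparr>"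
  have "\<exists>y\<in>S. x + y = 0" if "x \<in> S" for x
    using that assms(6) by (intro bexI[of _ "- x"]) auto
  moreover have "\<exists>y\<in>S. x * y = 1" if "x \<in> S" "x \<noteq> 0" for x
    using that assms(7) by (intro bexI[of _ "inverse x"]) auto
  ultimately interpret R: field R
    unfolding R_def
    by unfold_locales (use assms(1-5) in \<open>auto simp: algebra_simps Units_def\<close>)
  obtain g where g: "g \<in> carrier (mult_of R)" "carrier (mult_of R) = {g [^]\<^bsub>R\<^esub> i | i::nat. i \<in> UNIV}"
    using R.finite_field_mult_group_has_gen assms(1) by (auto simp: R_def)
  have "g [^]\<^bsub>R\<^esub> i = g ^ i" for i :: nat
    by (induction i) (simp_all add: R_def mult.commute)
  then have "S - {0} = range (\<lambda>i::nat. g ^ i)" "g \<in> S" "g \<noteq> 0"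
    using g by (auto simp: R_def)
  then show thesis by (intro that)
qed

lemma geometric_sum_nat: "(q - 1) * (\<Sum>i\<le>n. q ^ i) + 1 = q ^ (n + 1)" if "0 < q" for q :: nat
proof -
  obtain r where q: "q = Suc r" using gr0_implies_Suc \<open>0 < q\<close> by blast
  show ?thesis by (induction n) (simp_all add: q algebra_simps)
qed

text \<open>The fixed points of a Frobenius power form the field of order \<open>q ^ (n + 1)\<close>
  inside the algebraic closure. The order of a generator determines which powers are scalars, and
  counting excludes short linear relations. The closure properties of \<open>S\<close> make it a
  vector space over \<open>'f\<close>.\<close>

lemma singer_cycle_exists:
  fixes q n :: nat
  assumes card_f: "card (UNIV :: 'f::{field,finite} set) = q" and "primepow q" and n: "3 \<le> n"
  defines "S \<equiv> {x :: 'f alg_closure. x ^ (q ^ (n + 1)) = x}"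
  obtains g where "singer_cycle (range (to_ac :: 'f \<Rightarrow> _)) g q (\<Sum>i\<le>n. q ^ i)"
    "S - {0} = range (\<lambda>i::nat. g ^ i)" "finite S" "card S = q ^ (n + 1)"
    "\<And>x y. x \<in> S \<Longrightarrow> y \<in> S \<Longrightarrow> x + y \<in> S" "\<And>c x. x \<in> S \<Longrightarrow> to_ac c * x \<in> S"
proof -
  define F where "F = range (to_ac :: 'f \<Rightarrow> _)"
  define v where "v = (\<Sum>i\<le>n. q ^ i)"
  define Q where "Q = q ^ (n + 1)"
  have S: "x \<in> S \<longleftrightarrow> x ^ Q = x" for x by (simp add: S_def Q_def)
  obtain p e where pe: "normalization_semidom_class.prime p" "0 < e" "q = p ^ e" using \<open>primepow q\<close> by (auto simp: primepow_def)
  have q2: "2 \<le> q" using primepow_gt_Suc_0[OF \<open>primepow q\<close>] by simp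
  have "normalization_semidom_class.prime CHAR('f)" using finite_imp_CHAR_pos[where ?'a = 'f] by (simp add: prime_CHAR_semidom)
  moreover have "CHAR('f) dvd p ^ e" using CHAR_dvd_CARD[where ?'a = 'f] card_f pe by simp
  ultimately have char: "CHAR('f) = p" using pe by (meson prime_dvd_power primes_dvd_imp_eq)
  have Qv: "Q - 1 = (q - 1) * v" using geometric_sum_nat[of q n] q2 unfolding Q_def v_def by linarith
  have Q4: "q ^ 4 \<le> Q" unfolding Q_def using n q2 by (intro power_increasing) auto
  have q4: "4 * q ^ 2 \<le> q ^ 4"
  proof -
    have "2 ^ 2 \<le> q ^ 2" using q2 by (rule power_mono) simp
    then have "4 * q ^ 2 \<le> q ^ 2 * q ^ 2" by (intro mult_right_mono) simp_all
    then show ?thesis by (simp flip: power_add)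
  qed
  have "4 \<le> q ^ 2" using power_mono[of 2 q 2] q2 by simp
  then have Q2: "2 \<le> Q" using Q4 q4 by linarith
  have "of_nat Q = (0 :: 'f alg_closure)"
    using pe by (simp add: of_nat_eq_0_iff_char_dvd char Q_def)
  then have finS: "finite S" and cardS: "card S = Q"
    using card_fixed_points_power[of Q] Q2 by (auto simp: S_def Q_def)
  \<comment> \<open>Being a power of the characteristic, \<open>Q\<close> is an exponent that
    respects sums, which gives closure of \<open>S\<close> under addition.\<close>
  have Qp: "Q = CHAR('f alg_closure) ^ (e * (n + 1))" by (simp only: Q_def pe(3) char power_mult CHAR_alg_closure)
  have S0: "0 \<in> S" and S1: "1 \<in> S" using Q2 by (auto simp: S)
  have Sadd: "x + y \<in> S" if "x \<in> S" "y \<in> S" for x y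
    using that freshmans_dream'[OF _ Qp, of x y] pe char by (simp add: S)
  have Smult: "x * y \<in> S" if "x \<in> S" "y \<in> S" for x y using that by (simp add: S power_mult_distrib)
  have Sinv: "inverse x \<in> S" if "x \<in> S" for x using that by (simp add: S power_inverse)
  have Fq: "x ^ q = x" if x: "x \<in> F" for x
  proof (cases "x = 0")
    case False
    obtain c where c: "x = to_ac c" "c \<noteq> 0" using x False by (auto simp: F_def)
    have "c ^ card (UNIV - {0 :: 'f}) = 1" by (rule power_card_eq_1) (use c in auto)
    then have "c ^ Suc (q - 1) = c" using card_f by simp
    then have "c ^ q = c" using q2 by simp
    then show ?thesis using c by (metis to_ac_power)
  qed (use q2 in simp)
  have FS: "x \<in> S" if "x \<in> F" for x
  proof -
    have "x ^ (q ^ m) = x" for m by (induction m) (simp_all add: Fq that power_mult)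
    then show ?thesis unfolding S Q_def .
  qed
  \<comment> \<open>Using that -1 is a scalar avoids distinguishing even and odd
    characteristic.\<close>
  have Sminus: "- x \<in> S" if "x \<in> S" for x
  proof -
    have "- 1 = (to_ac (- 1) :: 'f alg_closure)" by simp
    then have "- 1 \<in> F" unfolding F_def by blast
    then show ?thesis using Smult[OF FS[of "- 1"] that] by simp
  qed
  obtain g where g: "g \<in> S" "g \<noteq> 0" "S - {0} = range (\<lambda>i::nat. g ^ i)"
    using finite_subfield_generator[OF finS S0 S1 Sadd Smult Sminus Sinv] .
  have cardS1: "card (S - {0}) = Q - 1" using cardS S0 by simp
  have gQ: "g ^ (Q - 1) = 1"
  proof -
    have "g ^ card (S - {0}) = 1" by (rule power_card_eq_1) (use finS g(1,2) Smult in auto)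
    then show ?thesis by (simp only: cardS1)
  qed
  have g_mod: "g ^ i = g ^ (i mod (Q - 1))" for i
  proof -
    have "g ^ i = g ^ ((Q - 1) * (i div (Q - 1)) + i mod (Q - 1))" by simp
    also have "\<dots> = g ^ (i mod (Q - 1))" unfolding power_add power_mult gQ by simp
    finally show ?thesis .
  qed
  have "range (\<lambda>i. g ^ i) = (\<lambda>i. g ^ i) ` {..<Q - 1}"
  proof (intro equalityI subsetI)
    fix x assume "x \<in> range (\<lambda>i. g ^ i)"
    then obtain i where "x = g ^ (i mod (Q - 1))" using g_mod by blast
    moreover have "i mod (Q - 1) < Q - 1" using Q2 by simp
    ultimately show "x \<in> (\<lambda>i. g ^ i) ` {..<Q - 1}" by blast
  qed auto
  \<comment> \<open>There are as many exponents below \<open>Q - 1\<close> as nonzero elements of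
    \<open>S\<close>, so \<open>g\<close> has order exactly \<open>Q - 1\<close>.\<close>
  then have inj: "inj_on (\<lambda>i. g ^ i) {..<Q - 1}"
    using cardS1 g(3) by (intro eq_card_imp_inj_on) simp_all
  have g1: "g ^ i = 1 \<longleftrightarrow> Q - 1 dvd i" for i
  proof
    assume "g ^ i = 1"
    then have "g ^ (i mod (Q - 1)) = g ^ 0" using g_mod by simp
    then have "i mod (Q - 1) = 0" using inj_onD[OF inj] Q2 by auto
    then show "Q - 1 dvd i" by auto
  qed (use gQ in \<open>auto simp: power_mult\<close>)
  have cardF: "card F = q" using card_f by (simp add: F_def card_image inj_to_ac)
  have F_iff: "x \<in> F \<longleftrightarrow> x ^ q = x" for x
  proof -
    have "of_nat q = (0 :: 'f alg_closure)" using pe by (simp add: of_nat_eq_0_iff_char_dvd char)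
    then have "finite {x :: 'f alg_closure. x ^ q = x}" "card {x :: 'f alg_closure. x ^ q = x} = q"
      using card_fixed_points_power q2 by blast+
    then have "F = {x. x ^ q = x}" using cardF Fq by (intro card_subset_eq) auto
    then show ?thesis by blast
  qed
  \<comment> \<open>A power lies in \<open>F\<close> iff its \<open>(q - 1)\<close>-th power is
    \<open>1\<close>, that is, iff \<open>Q - 1 = (q - 1) * v\<close> divides
    \<open>i * (q - 1)\<close>.\<close>
  have powF: "g ^ i \<in> F \<longleftrightarrow> v dvd i" for i
  proof -
    have "g ^ i \<in> F \<longleftrightarrow> (g ^ i) ^ Suc (q - 1) = g ^ i" using F_iff q2 by simp
    also have "\<dots> \<longleftrightarrow> g ^ (i * (q - 1)) = 1" using g(2) by (simp add: power_mult)
    also have "\<dots> \<longleftrightarrow> v dvd i" unfolding g1 Qv using q2 by (simp add: mult.commute[of i])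
    finally show ?thesis .
  qed
  text \<open>A set closed under multiplication by \<open>g ^ r\<close> contains all powers of \<open>g ^ r\<close>, so it is large;
    a linear relation between few powers of \<open>g\<close> would make a small span closed in this way.\<close>
  have growth: "(Q - 1) div r < card W"
    if W: "finite W" "0 \<in> W" "1 \<in> W" "\<And>w. w \<in> W \<Longrightarrow> g ^ r * w \<in> W" and "0 < r" for r W
  proof -
    have mem: "(g ^ r) ^ i \<in> W" for i by (induction i) (simp_all add: W)
    have less: "r * i < Q - 1" if "i < (Q - 1) div r" for i
    proof -
      have "r * Suc i \<le> r * ((Q - 1) div r)" using that by (intro mult_left_mono) auto
      also have "\<dots> \<le> Q - 1" by simp
      finally show ?thesis using \<open>0 < r\<close> by simp
    qed
    have "inj_on (\<lambda>i. (g ^ r) ^ i) {..<(Q - 1) div r}"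
    proof (rule inj_onI)
      fix i j assume "i \<in> {..<(Q - 1) div r}" "j \<in> {..<(Q - 1) div r}" "(g ^ r) ^ i = (g ^ r) ^ j"
      then have "r * i = r * j"
        using less by (intro inj_onD[OF inj]) (simp_all add: power_mult)
      then show "i = j" using \<open>0 < r\<close> by simp
    qed
    moreover have "(\<lambda>i. (g ^ r) ^ i) ` {..<(Q - 1) div r} \<subseteq> W - {0}" using mem g(2) by auto
    ultimately have "(Q - 1) div r \<le> card (W - {0})"
      using W(1) by (metis card_image card_lessThan card_mono finite_Diff)
    then show ?thesis using W(1,2) by (metis card_Diff1_less le_less_trans)
  qed
  have Fcl: "a + b \<in> F" "a * b \<in> F" "- a \<in> F" "inverse a \<in> F" if "a \<in> F" "b \<in> F" for a b
    using that unfolding F_def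
    by (auto simp flip: to_ac_add to_ac_mult to_ac_minus to_ac_inverse)
  have F01: "0 \<in> F" "1 \<in> F" using q2 F_iff by auto
  have finF: "finite F" by (simp add: F_def)
  \<comment> \<open>The relation would close the span of \<open>1\<close>, \<open>g\<close>,
    \<open>g ^ 2\<close> under \<open>g\<close>. It has at most \<open>q ^ 3\<close> elements, but
    \<open>growth\<close> with \<open>r = 1\<close> demands at least \<open>Q\<close>.\<close>
  have cubic: False if F: "a \<in> F" "b \<in> F" "c \<in> F" "d \<in> F" "d \<noteq> 0"
    and rel: "a + b * g + c * g ^ 2 + d * g ^ 3 = 0" for a b c d
  proof -
    define W where "W = (\<lambda>(x, y, z). x + y * g + z * g ^ 2) ` (F \<times> F \<times> F)"
    have WI: "x + y * g + z * g ^ 2 \<in> W" if "x \<in> F" "y \<in> F" "z \<in> F" for x y z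
      using that unfolding W_def by (intro image_eqI[of _ _ "(x, y, z)"]) auto
    have "g * w \<in> W" if "w \<in> W" for w
    proof -
      obtain x y z where xyz: "x \<in> F" "y \<in> F" "z \<in> F" "w = x + y * g + z * g ^ 2"
        using \<open>w \<in> W\<close> unfolding W_def by auto
      have "d * g ^ 3 = - (a + b * g + c * g ^ 2)" by (rule minus_unique[OF rel, symmetric])
      then have g3: "g ^ 3 = inverse d * - (a + b * g + c * g ^ 2)" using F(5) by (simp add: field_simps)
      have "g * w = x * g + y * g ^ 2 + z * g ^ 3"
        unfolding xyz(4) by (simp add: algebra_simps power2_eq_square power3_eq_cube)
      then have "g * w = z * - a * inverse d + (x + z * - b * inverse d) * g + (y + z * - c * inverse d) * g ^ 2"
        unfolding g3 by (simp add: algebra_simps)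
      then show ?thesis using F xyz Fcl by (simp only: WI)
    qed
    moreover have "finite W" using finF by (simp add: W_def)
    moreover have "0 \<in> W" "1 \<in> W" using WI[of 0 0 0] WI[of 1 0 0] F01 by auto
    ultimately have "Q - 1 < card W" using growth[of W 1] by simp
    also have "card W \<le> card (F \<times> F \<times> F)" unfolding W_def using finF by (intro card_image_le) simp
    also have "\<dots> = q ^ 3" by (simp add: card_cartesian_product cardF power3_eq_cube)
    finally have "Q \<le> q ^ 3" by simp
    moreover have "2 * q ^ 3 \<le> q * q ^ 3" using q2 by (rule mult_right_mono) simp
    moreover have "0 < q ^ 3" using q2 by simp
    moreover have "q * q ^ 3 = q ^ 4" by (simp add: eval_nat_numeral)
    ultimately show False using Q4 by linarith
  qed
  \<comment> \<open>Here the span of \<open>1\<close> and \<open>g ^ 2\<close>, of size at most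
    \<open>q ^ 2\<close>, would be closed under \<open>g ^ 2\<close>. The even powers alone are too
    many, since \<open>4 * q ^ 2 \<le> Q\<close>.\<close>
  have quartic: False if F: "a \<in> F" "b \<in> F" and rel: "g ^ 4 = a + b * g ^ 2" for a b
  proof -
    define W where "W = (\<lambda>(x, y). x + y * g ^ 2) ` (F \<times> F)"
    have WI: "x + y * g ^ 2 \<in> W" if "x \<in> F" "y \<in> F" for x y
      using that unfolding W_def by (intro image_eqI[of _ _ "(x, y)"]) auto
    have "g ^ 2 * w \<in> W" if "w \<in> W" for w
    proof -
      obtain x y where xy: "x \<in> F" "y \<in> F" "w = x + y * g ^ 2"
        using \<open>w \<in> W\<close> unfolding W_def by auto
      have "g ^ 2 * w = x * g ^ 2 + y * g ^ 4" unfolding xy(3) by (simp add: algebra_simps flip: power_add)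
      then have "g ^ 2 * w = y * a + (x + y * b) * g ^ 2" unfolding rel by (simp add: algebra_simps)
      then show ?thesis using F xy Fcl by (simp only: WI)
    qed
    moreover have "finite W" using finF by (simp add: W_def)
    moreover have "0 \<in> W" "1 \<in> W" using WI[of 0 0] WI[of 1 0] F01 by auto
    ultimately have "(Q - 1) div 2 < card W" using growth[of W 2] by simp
    also have "card W \<le> card (F \<times> F)" unfolding W_def using finF by (intro card_image_le) simp
    also have "\<dots> = q ^ 2" by (simp add: card_cartesian_product cardF power2_eq_square)
    finally show False using Q4 q4 \<open>4 \<le> q ^ 2\<close> by linarith
  qed
  have "singer_cycle F g q v"
  proof
    show "a = 0 \<and> b = 0 \<and> c = 0 \<and> d = 0"
      if F: "a \<in> F" "b \<in> F" "c \<in> F" "d \<in> F" and rel: "a + b * g + c * g ^ 2 + d * g ^ 3 = 0" for a b c d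
    proof -
      have d: "d = 0" using cubic F rel by blast
      \<comment> \<open>Multiplying the relation by \<open>g\<close>, and later by
        \<open>g ^ 2\<close>, moves the next coefficient into cubic position, so
        \<open>cubic\<close> applies again.\<close>
      have "0 + a * g + b * g ^ 2 + c * g ^ 3 = g * (a + b * g + c * g ^ 2 + d * g ^ 3)"
        unfolding d by (simp add: algebra_simps power2_eq_square power3_eq_cube)
      then have c: "c = 0" using cubic[of 0 a b c] F F01 rel by auto
      have "0 + 0 * g + a * g ^ 2 + b * g ^ 3 = g ^ 2 * (a + b * g + c * g ^ 2 + d * g ^ 3)"
        unfolding c d by (simp add: algebra_simps power2_eq_square power3_eq_cube)
      then have "b = 0" using cubic[of 0 0 a b] F F01 rel by auto
      then show ?thesis using c d rel by simp
    qed
    have "(\<Sum>i\<le>3. q ^ i) \<le> v" unfolding v_def using n by (intro sum_mono2) auto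
    then show "q ^ 3 + q ^ 2 + q + 1 \<le> v" by (simp add: numeral_eq_Suc)
    show "g ^ 4 \<noteq> a + b * g ^ 2" if "a \<in> F" "b \<in> F" for a b
      using quartic that by blast
  qed (use F01 Fcl cardF q2 g powF in auto)
  then show thesis
    using that[of g] g(3) finS cardS Sadd Smult FS unfolding F_def v_def Q_def by auto
qed

section \<open>Embedding cycle graphs\<close>

text \<open>Walk along edges without turning back. The first repeated vertex must be the start,
  since any other visited vertex already has its two neighbours on the walk. The visited set is
  closed under adjacency, so connectedness makes it all of \<open>V\<close>.\<close>

lemma cycle_graph_enumeration:
  assumes cyc: "cycle_graph k V E" and k: "3 \<le> k"
  obtains p where "bij_betw p {..<k} V" "E \<subseteq> (\<lambda>i. {p i, p (Suc i mod k)}) ` {..<k}"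
proof -
  have fV: "finite V" and edge: "\<And>e. e \<in> E \<Longrightarrow> e \<subseteq> V \<and> card e = 2"
    and conn: "\<And>u w. u \<in> V \<Longrightarrow> w \<in> V \<Longrightarrow> (u, w) \<in> {(x, y). {x, y} \<in> E}\<^sup>*"
    and cV: "card V = k" and deg: "\<And>u. u \<in> V \<Longrightarrow> card {e \<in> E. u \<in> e} = 2"
    using cyc by (auto simp: cycle_graph_def simple_graph_def connected_graph_def vertex_degree_def)
  have neq: "u \<noteq> w" "u \<in> V" "w \<in> V" if "{u, w} \<in> E" for u w
    using edge[OF that] by (auto simp: card_2_iff doubleton_eq_iff)
  have nbrs: "card {w. {u, w} \<in> E} = 2" if "u \<in> V" for u
  proof -
    have "{e \<in> E. u \<in> e} = (\<lambda>w. {u, w}) ` {w. {u, w} \<in> E}"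
    proof (intro equalityI subsetI)
      fix e assume e: "e \<in> {e \<in> E. u \<in> e}"
      then obtain x y where "e = {x, y}" using edge by (metis (no_types, lifting) card_2_iff mem_Collect_eq)
      then show "e \<in> (\<lambda>w. {u, w}) ` {w. {u, w} \<in> E}" using e by (auto simp: insert_commute)
    qed auto
    moreover have "inj_on (\<lambda>w. {u, w}) {w. {u, w} \<in> E}"
      by (auto simp: inj_on_def doubleton_eq_iff)
    ultimately show ?thesis using deg[OF that] by (simp add: card_image)
  qed
  have other: "\<exists>!x. x \<noteq> u \<and> {w, x} \<in> E" if "{u, w} \<in> E" for u w
  proof -
    have "w \<in> V" using neq that by blast
    then obtain a b where ab: "{x. {w, x} \<in> E} = {a, b}" "a \<noteq> b"
      using nbrs by (meson card_2_iff)
    have iff: "{w, x} \<in> E \<longleftrightarrow> x = a \<or> x = b" for x using ab(1) by blast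
    have "{w, u} \<in> E" using that by (simp add: insert_commute)
    then show ?thesis using iff ab(2) by metis
  qed
  define nxt where "nxt u w = (THE x. x \<noteq> u \<and> {w, x} \<in> E)" for u w
  have nxt: "nxt u w \<noteq> u" "{w, nxt u w} \<in> E" if "{u, w} \<in> E" for u w
    using theI'[OF other[OF that]] by (simp_all add: nxt_def)
  have nxt_eq: "x = nxt u w" if "{u, w} \<in> E" "x \<noteq> u" "{w, x} \<in> E" for u w x
    using other[OF that(1)] nxt[OF that(1)] that(2,3) by blast
  have "V \<noteq> {}" using cV k by auto
  then obtain v0 where "v0 \<in> V" by blast
  then obtain v1 where v1: "{v0, v1} \<in> E" using nbrs[of v0] by (auto simp: card_2_iff)
  \<comment> \<open>The state holds two consecutive vertices, because the next vertex depends on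
    both.\<close>
  define d where "d = rec_nat (v0, v1) (\<lambda>_ (u, w). (w, nxt u w))"
  have d_Suc: "d (Suc i) = (snd (d i), nxt (fst (d i)) (snd (d i)))" for i
    by (simp add: d_def case_prod_beta)
  define p where "p i = fst (d i)" for i
  have pSuc: "snd (d i) = p (Suc i)" for i by (simp add: p_def d_Suc)
  have pE: "{p i, p (Suc i)} \<in> E" for i
  proof (induction i)
    case 0
    then show ?case using v1 by (simp add: p_def d_Suc, simp add: d_def)
  next
    case (Suc i)
    have "p (Suc (Suc i)) = nxt (p i) (p (Suc i))"
      by (metis d_Suc p_def pSuc snd_conv)
    then show ?case using nxt(2)[OF Suc] by simp
  qed
  have p_step: "p (Suc (Suc i)) = nxt (p i) (p (Suc i))" for i
    by (metis d_Suc p_def pSuc snd_conv)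
  have p_back: "p (Suc (Suc i)) \<noteq> p i" for i using nxt(1)[OF pE] p_step by simp
  have p_neq: "p (Suc i) \<noteq> p i" for i using neq(1)[OF pE[of i]] by simp
  have pV: "p i \<in> V" for i using neq[OF pE[of i]] by simp
  have two: "w = p i \<or> w = p (Suc (Suc i))" if "{p (Suc i), w} \<in> E" for i w
    using nxt_eq[OF pE[of i]] p_step that by metis
  have rep: "\<exists>j. \<exists>i<j. p i = p j"
  proof (rule ccontr)
    assume "\<not> ?thesis"
    then have "inj p" by (intro linorder_injI) metis
    moreover have "finite (range p)" using pV fV by (meson finite_subset image_subsetI)
    ultimately show False using finite_imageD by blast
  qed
  define j where "j = (LEAST j. \<exists>i<j. p i = p j)"
  have j_ex: "\<exists>i<j. p i = p j" unfolding j_def by (rule LeastI_ex[OF rep])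
  have j_inj: "p a \<noteq> p b" if "a < b" "b < j" for a b
    using not_less_Least[of b "\<lambda>j. \<exists>i<j. p i = p j"] that unfolding j_def by blast
  have inj: "inj_on p {..<j}" by (rule linorder_inj_onI) (use j_inj in auto)
  obtain i where i: "i < j" "p i = p j" using j_ex by blast
  obtain j' where j': "j = Suc j'" using i by (cases j) auto
  \<comment> \<open>Otherwise \<open>p j'\<close> is a neighbour of \<open>p i\<close>, hence
    \<open>p i'\<close> or \<open>p (Suc i)\<close>. This is an earlier repetition unless
    \<open>j' = Suc i\<close>, and then the walk has turned back.\<close>
  have "i = 0"
  proof (rule ccontr)
    assume "i \<noteq> 0"
    then obtain i' where i': "i = Suc i'" by (cases i) auto
    have "{p (Suc i'), p j'} \<in> E" using pE[of j'] i i' j' by (simp add: insert_commute)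
    then have "p j' = p i' \<or> p j' = p (Suc i)" using two i' by blast
    moreover have "i' < j'" using i i' j' by simp
    moreover have "Suc i \<noteq> j" using p_neq[of i] i by auto
    ultimately have "j' = Suc i"
      using j_inj[of i' j'] j_inj[of "Suc i" j'] j' i by (metis Suc_lessI lessI less_Suc_eq)
    then show False using p_back[of i] i j' by simp
  qed
  then have p0: "p j = p 0" using i by simp
  have j3: "3 \<le> j"
  proof -
    have "j \<noteq> 1" using p_neq[of 0] p0 by auto
    moreover have "j \<noteq> 2" using p_back[of 0] p0 by (auto simp: numeral_2_eq_2)
    ultimately show ?thesis using i by linarith
  qed
  have p_mod: "p (Suc a mod j) = p (Suc a)" if "a < j" for a
    using p0 that by (cases "Suc a = j") auto
  have closed: "\<exists>b<j. {u, w} = {p b, p (Suc b mod j)}" if uw: "{u, w} \<in> E" and u: "u \<in> p ` {..<j}" for u w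
  proof -
    obtain a where a: "a < j" "u = p a" using u by auto
    show ?thesis
    proof (cases a)
      case 0
      \<comment> \<open>Index 0 has no predecessor; the last vertex \<open>p j'\<close> takes that
        role.\<close>
      have "w = p 1 \<or> w = p j'"
      proof -
        have "{p 0, p 1} \<in> E" using pE[of 0] by simp
        have "{p j', p 0} \<in> E" using pE[of j'] j' p0 by simp
        then have "nxt (p j') (p 0) = p 1"
          using nxt_eq[of "p j'" "p 0" "p 1"] \<open>{p 0, p 1} \<in> E\<close> j_inj[of 1 j'] j' j3 by auto
        then show ?thesis using nxt_eq[OF \<open>{p j', p 0} \<in> E\<close>] uw a 0 by metis
      qed
      then show ?thesis
      proof
        assume "w = p 1"
        then show ?thesis using a 0 j3 by (intro exI[of _ 0]) auto
      next
        assume "w = p j'"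
        then show ?thesis using a 0 j' by (intro exI[of _ j']) auto
      qed
    next
      case (Suc a')
      then have "w = p a' \<or> w = p (Suc a)" using two uw a by blast
      then show ?thesis
      proof
        assume "w = p a'"
        then show ?thesis using a Suc by (intro exI[of _ a']) auto
      next
        assume "w = p (Suc a)"
        then show ?thesis using a p_mod[of a] by (intro exI[of _ a]) auto
      qed
    qed
  qed
  have V: "p ` {..<j} = V"
  proof
    show "p ` {..<j} \<subseteq> V" using pV by auto
    show "V \<subseteq> p ` {..<j}"
    proof
      fix w assume "w \<in> V"
      then have "(p 0, w) \<in> {(x, y). {x, y} \<in> E}\<^sup>*" using conn pV by blast
      then show "w \<in> p ` {..<j}"
      proof induction
        case base
        then show ?case using j3 by auto
      next
        case (step y z)
        then obtain b where "b < j" "{y, z} = {p b, p (Suc b mod j)}" using closed by blast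
        then show ?case by (auto simp: doubleton_eq_iff)
      qed
    qed
  qed
  then have "j = k" using card_image[OF inj] cV by simp
  show thesis
  proof (rule that[of p])
    show "bij_betw p {..<k} V" using inj V \<open>j = k\<close> by (simp add: bij_betw_def)
    show "E \<subseteq> (\<lambda>i. {p i, p (Suc i mod k)}) ` {..<k}"
    proof
      fix e assume e: "e \<in> E"
      then obtain u w where uw: "e = {u, w}" "u \<in> V" using edge by (fastforce simp: card_2_iff)
      then obtain b where "b < j" "{u, w} = {p b, p (Suc b mod j)}" using closed e V by blast
      then show "e \<in> (\<lambda>i. {p i, p (Suc i mod k)}) ` {..<k}" using uw \<open>j = k\<close> by blast
    qed
  qed
qed

section \<open>Spans and cycles in an abstract vector space\<close>

context vector_space
begin

lemma span_singleton_in_pg_points: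
  assumes "x \<noteq> 0"
  shows "local.span {x} \<in> pg_points scale"
proof -
  have "local.independent {x}" using assms by (simp add: local.dependent_single)
  then show ?thesis
    unfolding pg_points_def using local.dim_span_eq_card_independent by simp
qed

lemma span_Un_span: "local.span (local.span {x} \<union> local.span {y}) = local.span {x, y}"
  using local.span_Un[of "{x}" "{y}"] local.span_Un[of "local.span {x}" "local.span {y}"]
  by (simp only: local.span_span Un_insert_left Un_empty_left)

lemma span_pair: "local.span {x, y} = {scale a x + scale b y | a b. True}"
proof (intro equalityI subsetI)
  fix z assume "z \<in> local.span {x, y}"
  then obtain a b where "z - scale a x = scale b y"
    by (auto simp: local.span_insert[of x] local.span_singleton)
  then have "z = scale a x + scale b y" by (simp add: diff_eq_eq add.commute)
  then show "z \<in> {scale a x + scale b y | a b. True}" by blast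
next
  fix z assume "z \<in> {scale a x + scale b y | a b. True}"
  then obtain a b where z: "z = scale a x + scale b y" by blast
  have "scale a x \<in> local.span {x, y}" "scale b y \<in> local.span {x, y}"
    by (simp_all add: local.span_scale local.span_base)
  then show "z \<in> local.span {x, y}" unfolding z by (rule local.span_add)
qed

text \<open>Each new independent vector multiplies the size by the number of scalars, its
  coefficient being unique. This later recovers the dimension of \<open>S\<close> from its
  cardinality.\<close>

lemma card_span_independent:
  assumes "finite (UNIV :: 'a set)" "finite B" "local.independent B"
  shows "finite (local.span B) \<and> card (local.span B) = card (UNIV :: 'a set) ^ card B"
  using assms(2,3)
proof (induction B rule: finite_induct)
  case empty
  then show ?case by simp
next
  case (insert b B)
  have b: "b \<notin> local.span B" and B: "local.independent B"
    using insert.prems insert.hyps by (simp_all add: local.independent_insert)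
  let ?f = "\<lambda>(c, x). scale c b + x"
  have "local.span (insert b B) = ?f ` (UNIV \<times> local.span B)"
  proof (intro equalityI subsetI)
    fix x assume "x \<in> local.span (insert b B)"
    then obtain c where "x - scale c b \<in> local.span B" by (auto simp: local.span_insert)
    then show "x \<in> ?f ` (UNIV \<times> local.span B)"
      by (intro image_eqI[of _ _ "(c, x - scale c b)"]) auto
  next
    fix x assume "x \<in> ?f ` (UNIV \<times> local.span B)"
    then obtain c y where "x = scale c b + y" "y \<in> local.span B" by auto
    then show "x \<in> local.span (insert b B)"
      unfolding local.span_insert by (intro CollectI exI[of _ c]) simp
  qed
  moreover have "inj_on ?f (UNIV \<times> local.span B)"
  proof (rule inj_onI, clarify)
    fix c x d y assume xy: "x \<in> local.span B" "y \<in> local.span B" and eq: "scale c b + x = scale d b + y"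
    have "scale (c - d) b = y - x" using eq by (simp add: local.scale_left_diff_distrib algebra_simps)
    then have "scale (c - d) b \<in> local.span B" using xy by (simp add: local.span_diff)
    moreover have "c = d" if "scale (c - d) b \<in> local.span B"
    proof (rule ccontr)
      assume "c \<noteq> d"
      then show False using local.span_scale[OF that, of "inverse (c - d)"] b by simp
    qed
    ultimately show "c = d \<and> x = y" using eq by simp
  qed
  ultimately show ?case
    using insert.IH[OF B] insert.hyps assms(1)
    by (simp add: card_image card_cartesian_product)
qed

lemma cycle_embeds:
  assumes cyc: "cycle_graph k V E" "3 \<le> k"
    and nz: "\<And>i. i < k \<Longrightarrow> x i \<noteq> 0"
    and points: "inj_on (\<lambda>i. local.span {x i}) {..<k}"
    and lines: "inj_on (\<lambda>i. local.span {x i, x (Suc i mod k)}) {..<k}"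
  shows "embeds_into_pg scale V E"
proof -
  obtain p where p: "bij_betw p {..<k} V" and E: "E \<subseteq> (\<lambda>i. {p i, p (Suc i mod k)}) ` {..<k}"
    using cycle_graph_enumeration[OF cyc] .
  define r where "r = the_inv_into {..<k} p"
  have r_p: "r (p i) = i" if "i < k" for i
    using that p unfolding r_def bij_betw_def by (auto intro: the_inv_into_f_f)
  have r: "bij_betw r V {..<k}" unfolding r_def using p by (rule bij_betw_the_inv_into)
  define f where "f w = local.span {x (r w)}" for w
  have "inj_on f V"
    using comp_inj_on[OF bij_betw_imp_inj_on[OF r]] points bij_betw_imp_surj_on[OF r]
    by (simp add: f_def[abs_def] comp_def)
  moreover have "f ` V \<subseteq> pg_points scale"
    using bij_betwE[OF r] nz span_singleton_in_pg_points by (auto simp: f_def)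
  moreover have "inj_on (\<lambda>e. line_through scale (f ` e)) E"
  proof -
    have line: "line_through scale (f ` {p i, p (Suc i mod k)}) = local.span {x i, x (Suc i mod k)}"
      if "i < k" for i
    proof -
      \<comment> \<open>Since \<open>k\<close> is at least 3, consecutive indices differ, so the two
        points are distinct and determine a line.\<close>
      have j: "Suc i mod k < k" "Suc i mod k \<noteq> i"
        using that cyc(2) by (auto simp: mod_Suc)
      then have "local.span {x i} \<noteq> local.span {x (Suc i mod k)}"
        using inj_onD[OF points] that by auto
      then have "line_through scale {local.span {x i}, local.span {x (Suc i mod k)}}
          = local.span (local.span {x i} \<union> local.span {x (Suc i mod k)})"
        using that j by (intro line_through_eq_span span_singleton_in_pg_points nz) auto
      also have "\<dots> = local.span {x i, x (Suc i mod k)}"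
        by (rule span_Un_span)
      finally show ?thesis using r_p that j by (simp add: f_def)
    qed
    show ?thesis
    proof (rule inj_onI)
      fix e e' assume e: "e \<in> E" "e' \<in> E" and eq: "line_through scale (f ` e) = line_through scale (f ` e')"
      obtain i where i: "i < k" "e = {p i, p (Suc i mod k)}"
        using subsetD[OF E e(1)] by (elim imageE) simp
      obtain j where j: "j < k" "e' = {p j, p (Suc j mod k)}"
        using subsetD[OF E e(2)] by (elim imageE) simp
      have "local.span {x i, x (Suc i mod k)} = local.span {x j, x (Suc j mod k)}"
        using eq line[OF i(1)] line[OF j(1)] unfolding i(2) j(2) by simp
      then have "i = j" using inj_onD[OF lines] i(1) j(1) by simp
      then show "e = e'" using i j by simp
    qed
  qed
  ultimately show ?thesis unfolding embeds_into_pg_def pg_embedding_def by blast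
qed

end

section \<open>Pancyclicity\<close>

theorem theorem1:
  fixes scale :: "'f::{field,finite} \<Rightarrow> 'v::ab_group_add \<Rightarrow> 'v"
    and n q k :: nat
    and V :: "'w set" and E :: "'w set set"
  assumes "n \<ge> 3"
    and "primepow q"
    and "card (UNIV :: 'f set) = q"
    and "vector_space scale"
    and "vector_space.dim scale (UNIV :: 'v set) = n + 1"
    and "3 \<le> k" and "k \<le> (\<Sum>i\<le>n. q ^ i)"
    and "cycle_graph k V E"
  shows "embeds_into_pg scale V E"
proof -
  define v where "v = (\<Sum>i\<le>n. q ^ i)"
  define F where "F = range (to_ac :: 'f \<Rightarrow> 'f alg_closure)"
  define S where "S = {x :: 'f alg_closure. x ^ (q ^ (n + 1)) = x}"
  obtain g where sc: "singer_cycle F g q v" and gS: "S - {0} = range (\<lambda>i::nat. g ^ i)"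
    and S: "finite S" "card S = q ^ (n + 1)"
      "\<And>x y. x \<in> S \<Longrightarrow> y \<in> S \<Longrightarrow> x + y \<in> S" "\<And>c x. x \<in> S \<Longrightarrow> to_ac c * x \<in> S"
    using singer_cycle_exists[OF assms(3,2,1), folded F_def v_def S_def] by blast
  interpret singer_cycle F g q v by (rule sc)
  interpret W: vector_space scale by (rule assms(4))
  interpret K: vector_space "\<lambda>(c :: 'f) (x :: 'f alg_closure). to_ac c * x"
    by unfold_locales (simp_all add: algebra_simps)
  interpret KW: vector_space_pair "\<lambda>(c :: 'f) (x :: 'f alg_closure). to_ac c * x" scale
    by unfold_locales
  have powS: "g ^ i \<in> S" for i using gS by blast
  have span_line: "K.span {x, y} = line x y" for x y
    unfolding K.span_pair line_def by (auto simp: F_def)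
  have "0 \<in> S" using q_ge_2 by (simp add: S_def)
  then have subS: "K.subspace S" using S unfolding K.subspace_def by blast
  obtain B where B: "B \<subseteq> S" "K.independent B" "S \<subseteq> K.span B"
    using K.basis_exists[of S] by metis
  have finB: "finite B" using B(1) S(1) by (rule finite_subset)
  have spanB: "K.span B = S" using B K.span_minimal[OF _ subS] by blast
  have "q ^ card B = q ^ (n + 1)"
    using K.card_span_independent[OF _ finB B(2)] spanB S(2) assms(3) by simp
  then have cardB: "card B = n + 1" using q_ge_2 by (simp only: power_inject_exp)
  obtain C where C: "W.independent C" "card C = n + 1"
    using W.basis_exists[of UNIV] assms(5) by metis
  have "finite C" using C(2) card.infinite by fastforce
  then obtain h where h: "bij_betw h B C"
    using finite_same_card_bij[OF finB] cardB C(2) by metis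
  \<comment> \<open>Extending a bijection of bases linearly carries the field model into the given
    space. The map is controlled only on \<open>S\<close>, the span of \<open>B\<close>, which
    contains all points and lines used.\<close>
  define \<phi> where "\<phi> = KW.construct B h"
  have lin: "Vector_Spaces.linear (\<lambda>c x. to_ac c * x) scale \<phi>"
    unfolding \<phi>_def by (rule KW.linear_construct[OF B(2)])
  interpret \<phi>: Vector_Spaces.linear "\<lambda>(c :: 'f) (x :: 'f alg_closure). to_ac c * x" scale \<phi>
    by (rule lin)
  have \<phi>B: "\<phi> b = h b" if "b \<in> B" for b unfolding \<phi>_def using KW.construct_basis[OF B(2) that] .
  have "\<phi> ` B = C" "inj_on \<phi> B"
    using h \<phi>B by (auto simp: bij_betw_def inj_on_def)
  then have inj: "inj_on \<phi> S"
    using KW.linear_inj_on_span_independent_image[OF lin, of B] C(1) spanB by simp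
  obtain s where s: "\<And>i. i < k \<Longrightarrow> s i < v" "inj_on s {..<k}"
    "inj_on (\<lambda>i. line (g ^ s i) (g ^ s (Suc i mod k))) {..<k}"
    using cycle_exists[of k] assms(6,7) unfolding v_def by metis
  show ?thesis
  proof (rule W.cycle_embeds[OF assms(8,6)])
    show "\<phi> (g ^ s i) \<noteq> 0" for i
      using inj_onD[OF inj, of "g ^ s i" 0] powS \<open>0 \<in> S\<close> \<phi>.zero by auto
    show "inj_on (\<lambda>i. W.span {\<phi> (g ^ s i)}) {..<k}"
    proof (rule inj_onI)
      fix i j assume ij: "i \<in> {..<k}" "j \<in> {..<k}" and "W.span {\<phi> (g ^ s i)} = W.span {\<phi> (g ^ s j)}"
      then have "\<phi> (g ^ s i) \<in> W.span {\<phi> (g ^ s j)}" using W.span_base by blast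
      then obtain c where "\<phi> (g ^ s i) = \<phi> (to_ac c * g ^ s j)"
        by (auto simp: W.span_singleton \<phi>.scale)
      then have "g ^ s i = to_ac c * g ^ s j" using inj_onD[OF inj] powS S(4) by blast
      then have "s i = s j"
        using power_eq_scale[of "s i" "s j" "to_ac c"] s(1) ij by (simp add: F_def)
      then show "i = j" using inj_onD[OF s(2)] ij by blast
    qed
    show "inj_on (\<lambda>i. W.span {\<phi> (g ^ s i), \<phi> (g ^ s (Suc i mod k))}) {..<k}"
    proof (rule inj_onI)
      have eq: "W.span {\<phi> (g ^ a), \<phi> (g ^ b)} = \<phi> ` line (g ^ a) (g ^ b)" for a b
        using \<phi>.span_image[of "{g ^ a, g ^ b}"] by (simp add: span_line)
      have sub: "line (g ^ a) (g ^ b) \<subseteq> S" for a b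
        unfolding line_def using S(3,4) powS by (auto simp: F_def)
      fix i j assume ij: "i \<in> {..<k}" "j \<in> {..<k}"
        and "W.span {\<phi> (g ^ s i), \<phi> (g ^ s (Suc i mod k))} = W.span {\<phi> (g ^ s j), \<phi> (g ^ s (Suc j mod k))}"
      then have "line (g ^ s i) (g ^ s (Suc i mod k)) = line (g ^ s j) (g ^ s (Suc j mod k))"
        unfolding eq using inj_on_image_eq_iff[OF inj sub sub] by blast
      then show "i = j" using inj_onD[OF s(3)] ij by blast
    qed
  qed
qed

end
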